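(* Let $n$ be an even positive integer and $m$ a positive integer, and let $y_1,\ldots,y_n$ be complex numbers with $y_1+\cdots+y_n=0$. Then for all $z\in\mathbb{C}$, \[ \sum_{k=0}^{mn-1}\prod_{j=1}^{n}\vartheta_2\!\left(z+y_j+\tfrac{k\pi}{mn}\Big|\tau\right)=R_2(m,n;\tau)\,\vartheta_3(mnz\,|\,m^2n\tau), \] where \[ R_2(m,n;\tau)=mn\,q^{-\frac{n}{4}}\sum_{\substack{r_1,\ldots,r_n\in\mathbb{Z}\\ r_1+\cdots+r_n=\frac n2}}q^{r_1^2+\cdots+r_n^2}e^{-2i(r_1y_1+\cdots+r_ny_n)}. \]
   Context: Throughout, $\tau\in\mathbb{C}$ with $\Im(\tau)>0$, $q=e^{\pi i\tau}$, and $q^{\alpha}$ means $e^{\pi i\alpha\tau}$ for real $\alpha$. The Jacobi theta functions are $\vartheta_2(z|\tau)=q^{1/4}\sum_{n\in\mathbb{Z}}q^{n(n+1)}e^{(2n+1)iz}$ and $\vartheta_3(z|\tau)=\sum_{n\in\mathbb{Z}}q^{n^2}e^{2niz}$; $\vartheta_3(z|m^2n\tau)$ denotes $\vartheta_3$ with $\tau$ replaced by $m^2n\tau$. *)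

theory Defs
  imports "HOL-Analysis.Analysis"
begin

text \<open>\<open>qpow \<tau> \<alpha>\<close> is \<open>q\<^sup>\<alpha>\<close> for the nome \<open>q = e\<^bsup>\<pi>i\<tau>\<^esup>\<close>; it is not a power of the complex
  number \<open>q\<close>, so that no branch of the logarithm is involved.\<close>

definition qpow :: "complex \<Rightarrow> real \<Rightarrow> complex" where
  "qpow \<tau> \<alpha> = exp (of_real pi * \<i> * of_real \<alpha> * \<tau>)"

definition theta2 :: "complex \<Rightarrow> complex \<Rightarrow> complex" where
  "theta2 z \<tau> = qpow \<tau> (1/4) *
     (\<Sum>\<^sub>\<infinity>n\<in>(UNIV :: int set). qpow \<tau> (of_int (n * (n + 1))) * exp (of_int (2 * n + 1) * \<i> * z))"

definition theta3 :: "complex \<Rightarrow> complex \<Rightarrow> complex" where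
  "theta3 z \<tau> =
     (\<Sum>\<^sub>\<infinity>n\<in>(UNIV :: int set). qpow \<tau> (of_int (n\<^sup>2)) * exp (of_int (2 * n) * \<i> * z))"

text \<open>Integer tuples \<open>(r\<^sub>1, \<dots>, r\<^sub>n)\<close> with prescribed sum; extensionality makes each tuple
  correspond to exactly one function.\<close>

definition int_tuples_with_sum :: "nat \<Rightarrow> int \<Rightarrow> (nat \<Rightarrow> int) set" where
  "int_tuples_with_sum n s = {r \<in> {1..n} \<rightarrow>\<^sub>E (UNIV :: int set). (\<Sum>j=1..n. r j) = s}"

definition R2 :: "nat \<Rightarrow> nat \<Rightarrow> (nat \<Rightarrow> complex) \<Rightarrow> complex \<Rightarrow> complex" where
  "R2 m n y \<tau> = of_nat (m * n) * qpow \<tau> (- (real n / 4)) *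
     (\<Sum>\<^sub>\<infinity>r\<in>int_tuples_with_sum n (int (n div 2)).
        qpow \<tau> (of_int (\<Sum>j=1..n. (r j)\<^sup>2)) *
        exp (- 2 * \<i> * (\<Sum>j=1..n. of_int (r j) * y j)))"

end

theory Submission
  imports Defs
begin

text \<open>Expand the product of theta series into a sum over integer tuples \<open>r\<close>. Summing over \<open>k\<close> is a
  root-of-unity filter: only tuples with \<open>mn\<close> dividing \<open>r\<^sub>1 + \<dots> + r\<^sub>n + n/2\<close> survive, each with
  weight \<open>mn\<close>. These are exactly the tuples \<open>r\<^sub>j = mp - s\<^sub>j\<close> with \<open>p\<close> an integer and
  \<open>s\<^sub>1 + \<dots> + s\<^sub>n = n/2\<close>, and in these coordinates the summand factors into a term of
  \<open>\<vartheta>\<^sub>3(mnz | m\<^sup>2n\<tau>)\<close> indexed by \<open>p\<close> and a term of \<open>R\<^sub>2\<close> indexed by \<open>s\<close>.\<close>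

section \<open>Absolute convergence of Gaussian series over the integers\<close>

lemma summable_on_exp_minus_abs_int:
  "(\<lambda>n::int. exp (- \<bar>real_of_int n\<bar>)) summable_on UNIV"
proof -
  have "summable (\<lambda>n. norm (exp (- real n)))"
  proof -
    have "summable (\<lambda>n. exp (- 1 :: real) ^ n)"
      by (rule summable_geometric) simp
    thus ?thesis by (simp add: exp_of_nat_mult [symmetric])
  qed
  hence nat: "(\<lambda>n. exp (- real n)) summable_on UNIV"
    by (rule norm_summable_imp_summable_on)
  have "(\<lambda>n::int. exp (- \<bar>real_of_int n\<bar>)) summable_on range int"
    using nat by (subst summable_on_reindex) (auto simp: o_def inj_on_def)
  \<comment> \<open>Starting at 1 keeps the two ranges disjoint: 0 already lies in
    \<open>range int\<close>.\<close>
  moreover have "(\<lambda>n::int. exp (- \<bar>real_of_int n\<bar>)) summable_on (\<lambda>n. - int n) ` {1..}"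
    using summable_on_subset_banach [OF nat, of "{1..}"]
    by (subst summable_on_reindex) (auto simp: o_def inj_on_def)
  ultimately have "(\<lambda>n::int. exp (- \<bar>real_of_int n\<bar>)) summable_on
      range int \<union> (\<lambda>n. - int n) ` {1..}"
    by (rule summable_on_Un_disjoint) auto
  also have "range int \<union> (\<lambda>n. - int n) ` {1..} = UNIV"
  proof -
    have "k \<in> range int \<union> (\<lambda>n. - int n) ` {1..}" for k
    proof (cases "k \<ge> 0")
      case True
      thus ?thesis by (metis UnI1 nonneg_int_cases rangeI)
    next
      case False
      hence "k = - int (nat (- k))" "nat (- k) \<ge> 1" by auto
      thus ?thesis by blast
    qed
    thus ?thesis by blast
  qed
  finally show ?thesis .
qed

text \<open>Quadratic decay beats the linear term: completing the square yields a constant multiple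
  of \<open>exp (- \<bar>n\<bar>)\<close> as a majorant.\<close>

lemma abs_summable_on_gaussian_int:
  fixes a b c :: complex
  assumes "Re a < 0"
  shows "(\<lambda>n::int. norm (exp (a * of_int n ^ 2 + b * of_int n + c))) summable_on UNIV"
proof -
  define \<alpha> where "\<alpha> = - Re a"
  \<comment> \<open>The added 1 leaves a spare \<open>- t\<close> once the square is completed; this
    is the exponent of the majorant.\<close>
  define \<beta> where "\<beta> = \<bar>Re b\<bar> + 1"
  have \<alpha>: "\<alpha> > 0" using assms by (simp add: \<alpha>_def)
  have bound: "norm (exp (a * of_int n ^ 2 + b * of_int n + c)) \<le>
      exp (\<beta>\<^sup>2 / (4 * \<alpha>) + Re c) * exp (- \<bar>real_of_int n\<bar>)" for n :: int
  proof -
    define t where "t = \<bar>real_of_int n\<bar>"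
    have "Re (a * of_int n ^ 2 + b * of_int n + c) = - \<alpha> * t\<^sup>2 + Re b * of_int n + Re c"
      by (simp add: \<alpha>_def t_def flip: of_int_power)
    also have "Re b * of_int n \<le> \<bar>Re b\<bar> * t"
      unfolding t_def by (metis abs_ge_self abs_mult)
    also have "- \<alpha> * t\<^sup>2 + \<bar>Re b\<bar> * t \<le> \<beta>\<^sup>2 / (4 * \<alpha>) - t"
    proof -
      have "0 \<le> (2 * \<alpha> * t - \<beta>)\<^sup>2 / (4 * \<alpha>)" using \<alpha> by simp
      also have "\<dots> = \<alpha> * t\<^sup>2 - \<beta> * t + \<beta>\<^sup>2 / (4 * \<alpha>)"
        using \<alpha> by (simp add: field_simps power2_eq_square)
      finally show ?thesis by (simp add: \<beta>_def algebra_simps)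
    qed
    finally have "Re (a * of_int n ^ 2 + b * of_int n + c) \<le> (\<beta>\<^sup>2 / (4 * \<alpha>) + Re c) + - t"
      by simp
    thus ?thesis by (simp add: t_def flip: exp_add)
  qed
  show ?thesis
    by (rule Infinite_Sum.abs_summable_on_comparison_test'
        [OF summable_on_cmult_right [OF summable_on_exp_minus_abs_int] bound])
qed

section \<open>Root-of-unity filter\<close>

lemma sum_exp_root_of_unity:
  fixes M :: nat and N :: int
  assumes "M > 0"
  shows "(\<Sum>k<M. exp (2 * of_real pi * \<i> * of_int N * of_nat k / of_nat M)) =
    (if int M dvd N then of_nat M else (0::complex))"
proof -
  \<comment> \<open>The sum is geometric in the \<open>M\<close>-th root of unity \<open>w\<close>:
    it consists of \<open>M\<close> ones if \<open>w = 1\<close>, that is, if \<open>M\<close>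
    divides \<open>N\<close>, and equals \<open>(w ^ M - 1) / (w - 1) = 0\<close> otherwise.\<close>
  define w where "w = exp (2 * of_real pi * \<i> * of_int N / of_nat M :: complex)"
  have "exp (2 * of_real pi * \<i> * of_int N * of_nat k / of_nat M) = w ^ k" for k
    by (simp add: w_def exp_of_nat_mult [symmetric] mult_ac)
  hence eq: "(\<Sum>k<M. exp (2 * of_real pi * \<i> * of_int N * of_nat k / of_nat M)) = (\<Sum>k<M. w ^ k)"
    by simp
  have wM: "w ^ M = 1"
  proof -
    have "w ^ M = exp (of_int (2 * N) * (of_real pi * \<i>))"
      using assms by (simp add: w_def exp_of_nat_mult [symmetric] mult_ac)
    also have "\<dots> = 1" by (subst exp_eq_1) (auto)
    finally show ?thesis .
  qed
  have w1: "w = 1 \<longleftrightarrow> int M dvd N"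
  proof -
    have "w = 1 \<longleftrightarrow> (\<exists>k::int. real_of_int N = of_int (k * int M))"
      using assms by (auto simp: w_def exp_eq_1 field_simps)
    also have "\<dots> \<longleftrightarrow> (\<exists>k. N = k * int M)"
      by (simp only: of_int_eq_iff)
    finally show ?thesis by (auto simp: dvd_def mult_ac)
  qed
  show ?thesis
  proof (cases "w = 1")
    case True
    thus ?thesis using eq w1 by simp
  next
    case False
    thus ?thesis using eq w1 wM by (simp add: geometric_sum)
  qed
qed

section \<open>Products of theta series as absolutely convergent sums over tuples\<close>

lemma theta2_eq:
  "theta2 w \<tau> = (\<Sum>\<^sub>\<infinity>r\<in>(UNIV :: int set).
     exp (of_real pi * \<i> * \<tau> * (of_int r + 1/2)\<^sup>2 + (2 * of_int r + 1) * \<i> * w))"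
  \<comment> \<open>Since \<open>1/4 + n * (n + 1) = (n + 1/2)^2\<close>, the prefactor merges into
    the series and each term becomes a single exponential.\<close>
  unfolding theta2_def qpow_def infsum_cmult_right' [symmetric]
  by (rule infsum_cong) (simp add: algebra_simps power2_eq_square flip: exp_add)

lemma theta2_term_abs_summable:
  assumes "Im \<tau> > 0"
  shows "(\<lambda>r::int. norm (exp (of_real pi * \<i> * \<tau> * (of_int r + 1/2)\<^sup>2 + (2 * of_int r + 1) * \<i> * w)))
    summable_on UNIV"
proof -
  have "Re (of_real pi * \<i> * \<tau>) < 0" using assms by simp
  from abs_summable_on_gaussian_int [OF this, of "of_real pi * \<i> * \<tau> + 2 * \<i> * w"
      "of_real pi * \<i> * \<tau> / 4 + \<i> * w"]
  show ?thesis by (simp add: algebra_simps power2_eq_square)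
qed

text \<open>Passes between two notions of absolute summability: the product theorem is about the
  integral-based one and asks for countable index sets, which \<open>int\<close> provides.\<close>

lemma abs_summable_on_prod_PiE_int:
  fixes f :: "'a \<Rightarrow> int \<Rightarrow> complex"
  assumes "finite A" and "\<And>x. x \<in> A \<Longrightarrow> (\<lambda>k. norm (f x k)) summable_on UNIV"
  shows "(\<lambda>g. norm (\<Prod>x\<in>A. f x (g x))) summable_on (A \<rightarrow>\<^sub>E UNIV)"
  using abs_summable_on_prod_PiE [OF assms(1), of "\<lambda>_. UNIV" f] assms(2)
  unfolding abs_summable_equivalent [symmetric] by simp

lemma infsum_sum_finite:
  fixes f :: "'k \<Rightarrow> 'a \<Rightarrow> 'b :: {topological_comm_monoid_add, t2_space}"
  assumes "finite K" and "\<And>k. k \<in> K \<Longrightarrow> f k summable_on A"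
  shows "(\<Sum>k\<in>K. infsum (f k) A) = (\<Sum>\<^sub>\<infinity>x\<in>A. \<Sum>k\<in>K. f k x)"
proof -
  have "((\<lambda>x. \<Sum>k\<in>K. f k x) has_sum (\<Sum>k\<in>K. infsum (f k) A)) A"
    using assms by (induction K rule: finite_induct) (auto intro!: has_sum_add has_sum_infsum)
  thus ?thesis by (simp add: infsumI)
qed

text \<open>Absolute convergence of every factor allows the finite product of series to be
  multiplied out, and the exponents add up.\<close>

lemma prod_theta2_eq:
  fixes w :: "nat \<Rightarrow> complex" and n :: nat
  assumes "Im \<tau> > 0"
  defines "f \<equiv> \<lambda>r. exp (\<Sum>j=1..n. of_real pi * \<i> * \<tau> * (of_int (r j) + 1/2)\<^sup>2
                           + (2 * of_int (r j) + 1) * \<i> * w j)"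
  shows "f summable_on ({1..n} \<rightarrow>\<^sub>E UNIV)"
    and "(\<Prod>j=1..n. theta2 (w j) \<tau>) = (\<Sum>\<^sub>\<infinity>r\<in>{1..n} \<rightarrow>\<^sub>E UNIV. f r)"
proof -
  let ?t = "\<lambda>j r. exp (of_real pi * \<i> * \<tau> * (of_int r + 1/2)\<^sup>2 + (2 * of_int r + 1) * \<i> * w j)"
  have f: "f = (\<lambda>r. \<Prod>j\<in>{1..n}. ?t j (r j))"
    unfolding f_def by (simp add: exp_sum)
  note abs = theta2_term_abs_summable [OF assms(1)]
  have "(\<lambda>r. norm (f r)) summable_on ({1..n} \<rightarrow>\<^sub>E UNIV)"
    unfolding f by (rule abs_summable_on_prod_PiE_int) (use abs in auto)
  thus "f summable_on ({1..n} \<rightarrow>\<^sub>E UNIV)"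
    by (rule abs_summable_summable)
  show "(\<Prod>j=1..n. theta2 (w j) \<tau>) = (\<Sum>\<^sub>\<infinity>r\<in>{1..n} \<rightarrow>\<^sub>E UNIV. f r)"
    unfolding f theta2_eq by (rule infsum_prod_PiE_abs [symmetric]) (use abs in auto)
qed

section \<open>Coordinates on the tuples that survive the filter\<close>

lemma bij_betw_int_tuples_shift:
  fixes m n h :: nat
  assumes "n > 0" "m > 0"
  shows "bij_betw (\<lambda>(p, s). \<lambda>j\<in>{1..n}. int m * p - s j)
    (UNIV \<times> int_tuples_with_sum n (int h))
    {r \<in> {1..n} \<rightarrow>\<^sub>E UNIV. int (m * n) dvd (\<Sum>j=1..n. r j) + int h}"
    (is "bij_betw ?\<phi> ?S ?T")
proof -
  \<comment> \<open>The components \<open>m * p - s j\<close> sum to \<open>m * n * p - h\<close>,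
    so \<open>p\<close> is recovered as this quotient and then \<open>s j\<close> as
    \<open>m * p - r j\<close>.\<close>
  let ?p = "\<lambda>r. ((\<Sum>j=1..n. r j) + int h) div int (m * n)"
  have sum: "(\<Sum>j=1..n. int m * p - s j) + int h = int (m * n) * p"
    if "s \<in> int_tuples_with_sum n (int h)" for p s
    using that by (simp add: int_tuples_with_sum_def sum_subtractf)
  show ?thesis
  proof (rule bij_betw_byWitness [where f' = "\<lambda>r. (?p r, \<lambda>j\<in>{1..n}. int m * ?p r - r j)"])
    show "\<forall>x\<in>?S. (?p (?\<phi> x), \<lambda>j\<in>{1..n}. int m * ?p (?\<phi> x) - ?\<phi> x j) = x"
    proof (clarify, goal_cases)
      case (1 p s)
      have "?p (?\<phi> (p, s)) = p"
        using sum [OF 1(2), of p] assms by (simp del: of_nat_mult)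
      moreover have "(\<lambda>j\<in>{1..n}. int m * p - ?\<phi> (p, s) j) = s"
        using 1(2) by (auto simp: int_tuples_with_sum_def PiE_def extensional_def fun_eq_iff)
      ultimately show ?case by simp
    qed
    show "\<forall>r\<in>?T. ?\<phi> (?p r, \<lambda>j\<in>{1..n}. int m * ?p r - r j) = r"
      by (auto simp: PiE_def extensional_def fun_eq_iff)
    show "?\<phi> ` ?S \<subseteq> ?T"
      using sum by (auto simp del: of_nat_mult)
    show "(\<lambda>r. (?p r, \<lambda>j\<in>{1..n}. int m * ?p r - r j)) ` ?T \<subseteq> ?S"
    proof (rule image_subsetI)
      fix r assume "r \<in> ?T"
      \<comment> \<open>Membership in \<open>?T\<close> makes the division exact.\<close>
      hence "int (m * n) * ?p r = (\<Sum>j=1..n. r j) + int h"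
        by simp
      hence "(\<Sum>j=1..n. int m * ?p r - r j) = int h"
        by (simp add: sum_subtractf algebra_simps)
      thus "(?p r, \<lambda>j\<in>{1..n}. int m * ?p r - r j) \<in> ?S"
        by (simp add: int_tuples_with_sum_def)
    qed
  qed
qed

text \<open>Completing the square with \<open>s\<^sub>1 + \<dots> + s\<^sub>n = n/2\<close> makes the cross term between \<open>p\<close> and
  \<open>s\<close> vanish, so the shifted summand factors.\<close>

lemma theta2_product_term_shift:
  fixes m n h :: nat and p :: int and s :: "nat \<Rightarrow> int" and y :: "nat \<Rightarrow> complex"
  assumes "n = 2 * h" and s: "(\<Sum>j=1..n. s j) = int h" and y: "(\<Sum>j=1..n. y j) = 0"
  shows "(\<Sum>j=1..n. of_real pi * \<i> * \<tau> * (of_int (int m * p - s j) + 1/2)\<^sup>2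
            + (2 * of_int (int m * p - s j) + 1) * \<i> * (z + y j))
    = of_real pi * \<i> * (of_nat (m\<^sup>2 * n) * \<tau>) * of_int (p\<^sup>2)
      + of_int (2 * p) * \<i> * (of_nat (m * n) * z)
      + (of_real pi * \<i> * \<tau> * (of_int (\<Sum>j=1..n. (s j)\<^sup>2) - of_nat n / 4)
         - 2 * \<i> * (\<Sum>j=1..n. of_int (s j) * y j))"
proof -
  let ?c = "of_real pi * \<i> * \<tau>" and ?P = "of_nat m * of_int p :: complex"
  have s': "(\<Sum>j=1..n. complex_of_int (s j)) = of_nat h"
    using arg_cong [OF s, of complex_of_int] by simp
  have "(\<Sum>j=1..n. ?c * (of_int (int m * p - s j) + 1/2)\<^sup>2
            + (2 * of_int (int m * p - s j) + 1) * \<i> * (z + y j))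
      = (\<Sum>j=1..n. ?c * (?P + 1/2)\<^sup>2 + (2 * ?P + 1) * \<i> * z
           - (?c * (2 * ?P + 1) + 2 * \<i> * z) * of_int (s j) + (2 * ?P + 1) * \<i> * y j
           + ?c * of_int ((s j)\<^sup>2) - 2 * \<i> * (of_int (s j) * y j))"
    by (rule sum.cong) (simp_all add: algebra_simps power2_eq_square)
  \<comment> \<open>The terms linear in \<open>y j\<close> alone cancel because the
    \<open>y j\<close> sum to 0.\<close>
  also have "\<dots> = of_nat n * (?c * (?P + 1/2)\<^sup>2 + (2 * ?P + 1) * \<i> * z)
           - (?c * (2 * ?P + 1) + 2 * \<i> * z) * of_nat h
           + ?c * of_int (\<Sum>j=1..n. (s j)\<^sup>2) - 2 * \<i> * (\<Sum>j=1..n. of_int (s j) * y j)"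
    by (simp add: sum.distrib sum_subtractf sum_distrib_left [symmetric] s' y del: One_nat_def)
  \<comment> \<open>With \<open>n = 2 * h\<close>,
    \<open>n * (P + 1/2)^2 - h * (2 * P + 1) = n * P^2 - n/4\<close>, the source of the factor
    \<open>qpow \<tau> (- n/4)\<close>; the coefficient of \<open>\<i> * z\<close> becomes
    \<open>n * (2 * P + 1) - 2 * h = 2 * n * P\<close>.\<close>
  also have "\<dots> = of_real pi * \<i> * (of_nat (m\<^sup>2 * n) * \<tau>) * of_int (p\<^sup>2)
      + of_int (2 * p) * \<i> * (of_nat (m * n) * z)
      + (?c * (of_int (\<Sum>j=1..n. (s j)\<^sup>2) - of_nat n / 4)
         - 2 * \<i> * (\<Sum>j=1..n. of_int (s j) * y j))"
    unfolding assms(1) by (simp add: field_simps power2_eq_square)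
  finally show ?thesis .
qed

section \<open>Filtering, change of coordinates and factorization\<close>

theorem theorem3p2:
  fixes \<tau> z :: complex and m n :: nat and y :: "nat \<Rightarrow> complex"
  assumes "Im \<tau> > 0"
    and "n > 0" and "even n" and "m > 0"
    and "(\<Sum>j=1..n. y j) = 0"
  shows "(\<Sum>k<m * n. \<Prod>j=1..n. theta2 (z + y j + of_nat k * of_real pi / of_nat (m * n)) \<tau>)
       = R2 m n y \<tau> * theta3 (of_nat (m * n) * z) (of_nat (m\<^sup>2 * n) * \<tau>)"
proof -
  obtain h where h: "n = 2 * h" using \<open>even n\<close> by (elim evenE)
  define M where "M = m * n"
  have M: "M > 0" using assms by (simp add: M_def)
  define A where "A = {1..n} \<rightarrow>\<^sub>E (UNIV :: int set)"
  \<comment> \<open>The frequencies \<open>2 * r j + 1\<close> add up to \<open>2 * N r\<close>, an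
    even integer because \<open>n = 2 * h\<close>; shifting \<open>z\<close> by
    \<open>k * pi / M\<close> thus multiplies the term of \<open>r\<close> by the
    \<open>k\<close>-th power of an \<open>M\<close>-th root of unity.\<close>
  define N where "N r = (\<Sum>j=1..n. r j) + int h" for r :: "nat \<Rightarrow> int"
  define F where "F w r = exp (\<Sum>j=1..n. of_real pi * \<i> * \<tau> * (of_int (r j) + 1/2)\<^sup>2
                                + (2 * of_int (r j) + 1) * \<i> * (w + y j))" for w r
  define B where "B = {r \<in> A. int M dvd N r}"
  define C where "C = int_tuples_with_sum n (int h)"
  define P where "P p = qpow (of_nat (m\<^sup>2 * n) * \<tau>) (of_int (p\<^sup>2)) *
                        exp (of_int (2 * p) * \<i> * (of_nat (m * n) * z))" for p :: int
  define Q where "Q s = qpow \<tau> (of_int (\<Sum>j=1..n. (s j)\<^sup>2)) *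
        exp (- 2 * \<i> * (\<Sum>j=1..n. of_int (s j) * y j))" for s
  define \<phi> where "\<phi> = (\<lambda>(p, s). \<lambda>j\<in>{1..n}. int m * p - s j)"

  have summable: "F w summable_on A" for w
    unfolding F_def A_def by (rule prod_theta2_eq(1) [OF assms(1)])
  have prod: "(\<Prod>j=1..n. theta2 (w + y j) \<tau>) = infsum (F w) A" for w
    unfolding F_def A_def by (rule prod_theta2_eq(2) [OF assms(1)])
  have shift: "F (z + of_nat k * of_real pi / of_nat M) r =
      F z r * exp (2 * of_real pi * \<i> * of_int (N r) * of_nat k / of_nat M)" for k r
  proof -
    have "(\<Sum>j=1..n. (2 * complex_of_int (r j) + 1) * \<i> * (of_nat k * of_real pi / of_nat M))
        = 2 * of_real pi * \<i> * of_int (N r) * of_nat k / of_nat M"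
      unfolding N_def h
      by (simp add: sum.distrib algebra_simps add_divide_distrib
               flip: sum_distrib_left sum_distrib_right sum_divide_distrib)
    moreover have "(\<Sum>j=1..n. of_real pi * \<i> * \<tau> * (of_int (r j) + 1/2)\<^sup>2
            + (2 * of_int (r j) + 1) * \<i> * (z + of_nat k * of_real pi / of_nat M + y j))
        = (\<Sum>j=1..n. of_real pi * \<i> * \<tau> * (of_int (r j) + 1/2)\<^sup>2
            + (2 * of_int (r j) + 1) * \<i> * (z + y j))
          + (\<Sum>j=1..n. (2 * complex_of_int (r j) + 1) * \<i> * (of_nat k * of_real pi / of_nat M))"
      unfolding sum.distrib [symmetric] by (rule sum.cong) (simp_all only: algebra_simps)
    ultimately show ?thesis by (simp only: F_def exp_add)
  qed
  have factor: "F z (\<phi> (p, s)) = qpow \<tau> (- (real n / 4)) * P p * Q s" if "s \<in> C" for p s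
  proof -
    have s: "(\<Sum>j=1..n. s j) = int h" using that by (simp add: C_def int_tuples_with_sum_def)
    have "F z (\<phi> (p, s)) = exp (\<Sum>j=1..n. of_real pi * \<i> * \<tau> * (of_int (int m * p - s j) + 1/2)\<^sup>2
            + (2 * of_int (int m * p - s j) + 1) * \<i> * (z + y j))"
      unfolding F_def \<phi>_def by (intro arg_cong [of _ _ exp] sum.cong) auto
    thus ?thesis
      unfolding theta2_product_term_shift [OF h s assms(5)] P_def Q_def qpow_def exp_add [symmetric]
      by (simp add: algebra_simps flip: exp_add)
  qed
  have bij: "bij_betw \<phi> (UNIV \<times> C) B"
    using bij_betw_int_tuples_shift [OF assms(2,4), of h]
    unfolding \<phi>_def B_def C_def A_def N_def M_def .

  have "(\<Sum>k<M. \<Prod>j=1..n. theta2 (z + y j + of_nat k * of_real pi / of_nat M) \<tau>)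
      = (\<Sum>k<M. infsum (F (z + of_nat k * of_real pi / of_nat M)) A)"
    unfolding prod [symmetric] by (simp add: add_ac)
  also have "\<dots> = (\<Sum>\<^sub>\<infinity>r\<in>A. \<Sum>k<M. F (z + of_nat k * of_real pi / of_nat M) r)"
    by (rule infsum_sum_finite) (use summable in auto)
  also have "\<dots> = (\<Sum>\<^sub>\<infinity>r\<in>A. F z r * (if int M dvd N r then of_nat M else 0))"
    unfolding shift sum_distrib_left [symmetric] sum_exp_root_of_unity [OF M] ..
  also have "\<dots> = (\<Sum>\<^sub>\<infinity>r\<in>B. of_nat M * F z r)"
    by (rule infsum_cong_neutral) (auto simp: B_def)
  also have "\<dots> = of_nat M * (\<Sum>\<^sub>\<infinity>r\<in>B. F z r)"
    by (rule infsum_cmult_right')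
  also have "(\<Sum>\<^sub>\<infinity>r\<in>B. F z r) = (\<Sum>\<^sub>\<infinity>x\<in>UNIV \<times> C. F z (\<phi> x))"
    by (rule infsum_reindex_bij_betw [OF bij, symmetric])
  \<comment> \<open>Summing iteratively is legitimate because summability on \<open>A\<close>
    restricts to \<open>B\<close> and is carried along the bijection \<open>\<phi>\<close>.\<close>
  also have "\<dots> = (\<Sum>\<^sub>\<infinity>p. \<Sum>\<^sub>\<infinity>s\<in>C. F z (\<phi> (p, s)))"
  proof (rule infsum_Sigma_banach [symmetric])
    have "F z summable_on B"
      by (rule summable_on_subset_banach [OF summable]) (auto simp: B_def)
    thus "(\<lambda>x. F z (\<phi> x)) summable_on UNIV \<times> C"
      by (simp only: summable_on_reindex_bij_betw [OF bij])
  qed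
  also have "\<dots> = (\<Sum>\<^sub>\<infinity>p. \<Sum>\<^sub>\<infinity>s\<in>C. qpow \<tau> (- (real n / 4)) * P p * Q s)"
    by (intro infsum_cong factor)
  \<comment> \<open>In a field, constant factors leave an infinite sum even if it diverges, its
    value then being 0 by default.\<close>
  also have "\<dots> = qpow \<tau> (- (real n / 4)) * infsum P UNIV * infsum Q C"
    by (simp only: infsum_cmult_right' infsum_cmult_left')
  finally show ?thesis
    unfolding R2_def theta3_def M_def P_def Q_def C_def by (simp add: h mult_ac)
qed

end
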